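(* Let $(Q,* )$ be a finite quasigroup, $G\leq \mathrm{Aut}(Q)$, $e=(e_1,e_2,e_3)\in\mathrm{Ent}(L(Q))$ and $\alpha,\overline{\alpha}\in G$ such that (C1') $\alpha\in \mathrm{Stab}^{\mathrm{row}}_G(e)\setminus \mathrm{Stab}^{\mathrm{col}}_G(e)$; (C2') $\overline{\alpha}\in\mathrm{Stab}^{\mathrm{col}}_G(e)$; (C3') $\overline{\alpha}^{-1}\alpha\in \mathrm{Stab}^{\mathrm{sym}}_G(e)$; and suppose moreover that (B1) $\mathrm{Stab}^{\mathrm{row}}_G(e)=\langle\alpha\rangle$; (B2) $\mathrm{Stab}^{\mathrm{col}}_G(e)=\langle\overline{\alpha}\rangle$; (B3) $\mathrm{Stab}^{\mathrm{sym}}_G(e)=\langle\overline{\alpha}^{-1}\alpha\rangle$; (B4) $|\langle\alpha\rangle\cap\langle\overline{\alpha}\rangle|=1$. Let $a=\alpha^{-1}$, $b=\overline{\alpha}$, $c=\overline{\alpha}^{-1}\alpha$, $A=\langle a\rangle$, $B=\langle b\rangle$, $C=\langle c\rangle$. Let $T=\{g(e)\mid g\in G\}$ and $T'=\{g((e_1,e_2,\alpha(e_3)))\mid g\in G\}$, and let $T^\circ=\{(gA,gB,gC)\mid g\in G\}$ and $T^*=\{(gA,gB,ga^{-1}C)\mid g\in G\}$ (triples of left cosets in $G$). Then $(T,T')$ is isotopic to $(T^\circ,T^* )$ via the pair of maps $(\Theta,\Theta')$ given by $$\Theta(g(e))=(gA,gB,gC),\qquad \Theta'(g((e_1,e_2,\alpha(e_3))))=(gA,gB,ga^{-1}C)\qquad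 (g\in G).$$
   Context: A quasigroup $(Q,* )$ is a finite set $Q$ with a binary operation such that for all $i,j\in Q$ the equations $i*x=j$ and $y*i=j$ have unique solutions; write $ij$ for $i*j$. Its Cayley table $L(Q)$ is identified with $\mathrm{Ent}(L(Q))=\{(i,j,ij)\mid i,j\in Q\}$ (row, column, symbol). $\mathrm{Aut}(Q)$ is the group of permutations $f$ of $Q$ with $f(ij)=f(i)f(j)$ for all $i,j$; an automorphism $g$ acts on triples coordinatewise, $g((x_1,x_2,x_3))=(g(x_1),g(x_2),g(x_3))$. For $G\leq\mathrm{Aut}(Q)$ and $e=(e_1,e_2,e_3)$: $\mathrm{Stab}^{\mathrm{row}}_G(e)=\{g\in G\mid g(e_1)=e_1\}$, $\mathrm{Stab}^{\mathrm{col}}_G(e)=\{g\in G\mid g(e_2)=e_2\}$, $\mathrm{Stab}^{\mathrm{sym}}_G(e)=\{g\in G\mid g(e_3)=e_3\}$, and $\mathrm{Stab}_G(e)$ is their intersection. (In this setting $(T,T')$ is a Latin bitrade in $L(Q)$.) A set of triples $X$ is isotopic to a set of triples $Y$ via a map $\Phi:X\to Y$ if $\Phi$ is a well-defined bijection from $X$ onto $Y$ that preserves rows, columns and symbols, i.e. there are bijections $\varphi_1,\varphi_2,\varphi_3$ between the respective row, column and symbol label sets with $\Phi((x_1,x_2,x_3))=(\varphi_1(x_1),\varphi_2(x_2),\varphi_3(x_3))$; a pair $(T,T')$ is isotopic to $(T^\circ,T^* )$ via $(\Theta,\Theta')$ if $T$ is isotopic to $T^\circ$ via $\Theta$ and $T'$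 is isotopic to $T^*$ via $\Theta'$. *)

theory Defs
  imports "HOL-Algebra.Bij" "HOL-Algebra.Coset" "HOL-Algebra.Generated_Groups"
begin

definition finite_quasigroup :: "'a set \<Rightarrow> ('a \<Rightarrow> 'a \<Rightarrow> 'a) \<Rightarrow> bool" where
  "finite_quasigroup Q mul \<longleftrightarrow>
     finite Q \<and>
     (\<forall>i\<in>Q. \<forall>j\<in>Q. mul i j \<in> Q) \<and>
     (\<forall>i\<in>Q. \<forall>j\<in>Q. (\<exists>!x. x \<in> Q \<and> mul i x = j) \<and> (\<exists>!y. y \<in> Q \<and> mul y i = j))"

definition Ent :: "'a set \<Rightarrow> ('a \<Rightarrow> 'a \<Rightarrow> 'a) \<Rightarrow> ('a \<times> 'a \<times> 'a) set" where
  "Ent Q mul = {(i, j, mul i j) | i j. i \<in> Q \<and> j \<in> Q}"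

text \<open>As in \<^const>\<open>AutoGroup\<close>, permutations of \<open>Q\<close> are extensional functions and the product
  \<open>g \<otimes> f\<close> is the composition ``first \<open>f\<close>, then \<open>g\<close>''.  (\<^const>\<open>AutoGroup\<close> itself
  takes a monoid record, which would come with a spurious unit element.)\<close>

definition quasigroup_Aut :: "'a set \<Rightarrow> ('a \<Rightarrow> 'a \<Rightarrow> 'a) \<Rightarrow> ('a \<Rightarrow> 'a) monoid" where
  "quasigroup_Aut Q mul =
     (BijGroup Q)\<lparr>carrier := {f \<in> Bij Q. \<forall>i\<in>Q. \<forall>j\<in>Q. f (mul i j) = mul (f i) (f j)}\<rparr>"

lemma group_quasigroup_Aut:
  assumes "finite_quasigroup Q mul"
  shows "group (quasigroup_Aut Q mul)"
proof -
  let ?S = "{f \<in> Bij Q. \<forall>i\<in>Q. \<forall>j\<in>Q. f (mul i j) = mul (f i) (f j)}"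
  have clos: "mul \<in> Q \<rightarrow> Q \<rightarrow> Q"
    using assms by (auto simp: finite_quasigroup_def)
  have mem: "f x \<in> Q" if "f \<in> Bij Q" "x \<in> Q" for f x
    using Bij_imp_funcset[OF that(1)] that(2) by auto
  have "subgroup ?S (BijGroup Q)"
  proof (rule subgroup.intro)
    show "?S \<subseteq> carrier (BijGroup Q)"
      by (auto simp: BijGroup_def)
    show "x \<otimes>\<^bsub>BijGroup Q\<^esub> y \<in> ?S" if xy: "x \<in> ?S" "y \<in> ?S" for x y
    proof -
      have "x \<otimes>\<^bsub>BijGroup Q\<^esub> y = compose Q x y"
        using xy by (simp add: BijGroup_def)
      moreover have "compose Q x y (mul i j) = mul (compose Q x y i) (compose Q x y j)"
        if ij: "i \<in> Q" "j \<in> Q" for i j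
      proof -
        have "mul i j \<in> Q" using clos ij by blast
        moreover have "y i \<in> Q" "y j \<in> Q" using mem xy(2) ij by simp_all
        ultimately show ?thesis using xy ij by (simp add: compose_eq)
      qed
      ultimately show ?thesis using xy by (simp add: compose_Bij)
    qed
    show "\<one>\<^bsub>BijGroup Q\<^esub> \<in> ?S"
      using clos by (simp add: BijGroup_def id_Bij Pi_iff)
    show "inv\<^bsub>BijGroup Q\<^esub> x \<in> ?S" if "x \<in> ?S" for x
    proof -
      have x: "x \<in> Bij Q" using that by simp
      have "inv_into Q x (mul i j) = mul (inv_into Q x i) (inv_into Q x j)" if "i \<in> Q" "j \<in> Q" for i j
        by (rule Bij_inv_into_lemma) (use \<open>x \<in> ?S\<close> clos that in auto)
      moreover have "mul i j \<in> Q" if "i \<in> Q" "j \<in> Q" for i j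
        using clos that by blast
      ultimately show ?thesis
        using x by (simp add: inv_BijGroup restrict_inv_into_Bij)
    qed
  qed
  then show ?thesis
    unfolding quasigroup_Aut_def
    by (rule subgroup.subgroup_is_group[OF _ group_BijGroup])
qed

definition act :: "('a \<Rightarrow> 'a) \<Rightarrow> 'a \<times> 'a \<times> 'a \<Rightarrow> 'a \<times> 'a \<times> 'a" where
  "act g = (\<lambda>(x1, x2, x3). (g x1, g x2, g x3))"

definition Stab_row :: "('a \<Rightarrow> 'a) set \<Rightarrow> 'a \<times> 'a \<times> 'a \<Rightarrow> ('a \<Rightarrow> 'a) set" where
  "Stab_row G = (\<lambda>(e1, e2, e3). {g \<in> G. g e1 = e1})"

definition Stab_col :: "('a \<Rightarrow> 'a) set \<Rightarrow> 'a \<times> 'a \<times> 'a \<Rightarrow> ('a \<Rightarrow> 'a) set" where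
  "Stab_col G = (\<lambda>(e1, e2, e3). {g \<in> G. g e2 = e2})"

definition Stab_sym :: "('a \<Rightarrow> 'a) set \<Rightarrow> 'a \<times> 'a \<times> 'a \<Rightarrow> ('a \<Rightarrow> 'a) set" where
  "Stab_sym G = (\<lambda>(e1, e2, e3). {g \<in> G. g e3 = e3})"

definition rows :: "('r \<times> 'c \<times> 's) set \<Rightarrow> 'r set" where
  "rows X = {x1. \<exists>x2 x3. (x1, x2, x3) \<in> X}"

definition cols :: "('r \<times> 'c \<times> 's) set \<Rightarrow> 'c set" where
  "cols X = {x2. \<exists>x1 x3. (x1, x2, x3) \<in> X}"

definition syms :: "('r \<times> 'c \<times> 's) set \<Rightarrow> 's set" where
  "syms X = {x3. \<exists>x1 x2. (x1, x2, x3) \<in> X}"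

definition isotopic_via ::
  "('r \<times> 'c \<times> 's) set \<Rightarrow> ('u \<times> 'v \<times> 'w) set \<Rightarrow> ('r \<times> 'c \<times> 's \<Rightarrow> 'u \<times> 'v \<times> 'w) \<Rightarrow> bool"
where
  "isotopic_via X Y \<Phi> \<longleftrightarrow>
     bij_betw \<Phi> X Y \<and>
     (\<exists>\<phi>1 \<phi>2 \<phi>3.
        bij_betw \<phi>1 (rows X) (rows Y) \<and>
        bij_betw \<phi>2 (cols X) (cols Y) \<and>
        bij_betw \<phi>3 (syms X) (syms Y) \<and>
        (\<forall>(x1, x2, x3)\<in>X. \<Phi> (x1, x2, x3) = (\<phi>1 x1, \<phi>2 x2, \<phi>3 x3)))"

definition pair_isotopic_via ::
  "('r \<times> 'c \<times> 's) set \<times> ('r \<times> 'c \<times> 's) set \<Rightarrow>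
   ('u \<times> 'v \<times> 'w) set \<times> ('u \<times> 'v \<times> 'w) set \<Rightarrow>
   ('r \<times> 'c \<times> 's \<Rightarrow> 'u \<times> 'v \<times> 'w) \<times> ('r \<times> 'c \<times> 's \<Rightarrow> 'u \<times> 'v \<times> 'w) \<Rightarrow> bool"
where
  "pair_isotopic_via = (\<lambda>(T, T') (U, U') (\<Theta>, \<Theta>'). isotopic_via T U \<Theta> \<and> isotopic_via T' U' \<Theta>')"

end

theory Submission
  imports Defs
begin

text \<open>Each coordinate of a triple in the \<open>G\<close>-orbit of \<open>e\<close> lies in the \<open>G\<close>-orbit of one
  point, whose stabilizer is \<open>A\<close>, \<open>B\<close> or \<open>C\<close>; hence by the orbit-stabilizer
  correspondence \<open>g x = h x\<close> iff \<open>g\<close> and \<open>h\<close> lie in the same left coset, separately in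
  each coordinate.  For \<open>T'\<close> the symbol is \<open>g (\<alpha> e3) = (g \<otimes> a\<^sup>-\<^sup>1) e3\<close>, which gives the
  coset of \<open>g \<otimes> a\<^sup>-\<^sup>1\<close>.\<close>

text \<open>If \<open>g = h \<otimes> s\<close> with \<open>s\<close> fixing \<open>x\<close>, both
  send \<open>x\<close> to the same point; conversely, equal images make
  \<open>inv h \<otimes> g\<close> fix \<open>x\<close>. Multiplicativity is asked for only at
  \<open>x\<close>: the automorphisms here are extensional functions, whose product is given by
  composition only at points of \<open>Q\<close>.\<close>

lemma (in group) l_coset_stabilizer_eq_iff:
  fixes f :: "'a \<Rightarrow> 'x \<Rightarrow> 'x"
  assumes H: "subgroup H G"
    and mult: "\<And>g h. g \<in> H \<Longrightarrow> h \<in> H \<Longrightarrow> f (g \<otimes> h) x = f g (f h x)"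
    and one: "f \<one> x = x"
    and g: "g \<in> H" and h: "h \<in> H"
  shows "g <# {s \<in> H. f s x = x} = h <# {s \<in> H. f s x = x} \<longleftrightarrow> f g x = f h x"
    (is "g <# ?S = h <# ?S \<longleftrightarrow> _")
proof
  note H_mem = subgroup.mem_carrier[OF H]
  have "g = g \<otimes> \<one>"
    using g by (simp add: H_mem)
  then have "g \<in> g <# ?S"
    unfolding l_coset_def using subgroup.one_closed[OF H] one by blast
  moreover assume "g <# ?S = h <# ?S"
  ultimately obtain s where "s \<in> H" "f s x = x" "g = h \<otimes> s"
    by (auto simp: l_coset_def)
  then show "f g x = f h x"
    using mult[OF h] by simp
next
  note H_mem = subgroup.mem_carrier[OF H]
  \<comment> \<open>The hypothesis is symmetric in the two elements, so one inclusion, applied both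
    ways, gives equality.\<close>
  have incl: "k <# ?S \<subseteq> l <# ?S" if k: "k \<in> H" and l: "l \<in> H" and eq: "f k x = f l x" for k l
  proof
    fix y assume "y \<in> k <# ?S"
    then obtain s where s: "s \<in> H" "f s x = x" and y: "y = k \<otimes> s"
      by (auto simp: l_coset_def)
    have il: "inv l \<in> H"
      using subgroup.m_inv_closed[OF H l] .
    have ks: "k \<otimes> s \<in> H"
      using subgroup.m_closed[OF H k s(1)] .
    have "f (inv l \<otimes> (k \<otimes> s)) x = f (inv l) (f l x)"
      using mult[OF il ks] mult[OF k s(1)] s(2) eq by simp
    also have "\<dots> = x"
      using mult[OF il l] l one by (simp add: H_mem)
    finally have "inv l \<otimes> (k \<otimes> s) \<in> ?S"
      using subgroup.m_closed[OF H il ks] by simp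
    moreover have "y = l \<otimes> (inv l \<otimes> (k \<otimes> s))"
      using y l ks by (simp add: H_mem m_assoc[symmetric])
    ultimately show "y \<in> l <# ?S"
      unfolding l_coset_def by blast
  qed
  assume "f g x = f h x"
  then show "g <# ?S = h <# ?S"
    using incl[OF g h] incl[OF h g] by auto
qed

text \<open>Bridges the gap between \<open>A\<close>, generated by \<open>a = inv \<alpha>\<close>,
  and the row stabilizer, which \<open>B1\<close> describes through \<alpha>.\<close>

lemma (in group) generate_inv_singleton:
  assumes "x \<in> carrier G"
  shows "generate G {inv x} = generate G {x}"
proof
  show "generate G {inv x} \<subseteq> generate G {x}"
    by (rule generate_subgroup_incl)
      (use assms in \<open>auto intro: generate.inv generate_is_subgroup\<close>)
  have "x \<in> generate G {inv x}"
    using generate.inv[of "inv x" "{inv x}" G] assms by simp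
  then show "generate G {x} \<subseteq> generate G {inv x}"
    by (intro generate_subgroup_incl) (use assms in \<open>auto intro: generate_is_subgroup\<close>)
qed

text \<open>The two maps have the same fibres on \<open>I\<close>: one direction of the equivalence
  makes \<open>p g \<mapsto> q g\<close> well defined, the other makes it injective.\<close>

lemma ex_bij_betw_images:
  assumes "\<And>g h. g \<in> I \<Longrightarrow> h \<in> I \<Longrightarrow> p g = p h \<longleftrightarrow> q g = q h"
  obtains \<phi> where "bij_betw \<phi> (p ` I) (q ` I)" and "\<And>g. g \<in> I \<Longrightarrow> \<phi> (p g) = q g"
proof
  \<comment> \<open>The chosen preimage of \<open>p g\<close> may differ from \<open>g\<close>, but
    it has the same value under \<open>p\<close>, hence under \<open>q\<close>.\<close>
  show eq: "(q \<circ> inv_into I p) (p g) = q g" if "g \<in> I" for g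
    using assms[of "inv_into I p (p g)" g] that by (simp add: inv_into_into f_inv_into_f)
  show "bij_betw (q \<circ> inv_into I p) (p ` I) (q ` I)"
    unfolding bij_betw_def inj_on_def image_image using eq assms by (auto simp del: comp_apply)
qed

text \<open>With a common index set, comparing fibres in each coordinate separately suffices. Every
  label occurs in some triple, so the label sets are exactly the images of the coordinate maps, and
  the three label bijections together act injectively on triples.\<close>

lemma isotopic_via_parametrized:
  assumes X: "X = (\<lambda>g. (p1 g, p2 g, p3 g)) ` I" and Y: "Y = (\<lambda>g. (q1 g, q2 g, q3 g)) ` I"
    and 1: "\<And>g h. g \<in> I \<Longrightarrow> h \<in> I \<Longrightarrow> p1 g = p1 h \<longleftrightarrow> q1 g = q1 h"
    and 2: "\<And>g h. g \<in> I \<Longrightarrow> h \<in> I \<Longrightarrow> p2 g = p2 h \<longleftrightarrow> q2 g = q2 h"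
    and 3: "\<And>g h. g \<in> I \<Longrightarrow> h \<in> I \<Longrightarrow> p3 g = p3 h \<longleftrightarrow> q3 g = q3 h"
  obtains \<Phi> where "isotopic_via X Y \<Phi>"
    and "\<And>g. g \<in> I \<Longrightarrow> \<Phi> (p1 g, p2 g, p3 g) = (q1 g, q2 g, q3 g)"
proof -
  obtain \<phi>1 where \<phi>1: "bij_betw \<phi>1 (p1 ` I) (q1 ` I)" "\<And>g. g \<in> I \<Longrightarrow> \<phi>1 (p1 g) = q1 g"
    using ex_bij_betw_images[of I p1 q1] 1 by blast
  obtain \<phi>2 where \<phi>2: "bij_betw \<phi>2 (p2 ` I) (q2 ` I)" "\<And>g. g \<in> I \<Longrightarrow> \<phi>2 (p2 g) = q2 g"
    using ex_bij_betw_images[of I p2 q2] 2 by blast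
  obtain \<phi>3 where \<phi>3: "bij_betw \<phi>3 (p3 ` I) (q3 ` I)" "\<And>g. g \<in> I \<Longrightarrow> \<phi>3 (p3 g) = q3 g"
    using ex_bij_betw_images[of I p3 q3] 3 by blast
  define \<Phi> where "\<Phi> = (\<lambda>(x1, x2, x3). (\<phi>1 x1, \<phi>2 x2, \<phi>3 x3))"
  have eq: "\<Phi> (p1 g, p2 g, p3 g) = (q1 g, q2 g, q3 g)" if "g \<in> I" for g
    using that \<phi>1(2) \<phi>2(2) \<phi>3(2) by (simp add: \<Phi>_def)
  have "inj_on \<Phi> X"
    unfolding X using eq 1 2 3 by (auto simp: inj_on_def)
  moreover have "\<Phi> ` X = Y"
    unfolding X Y image_image using eq by (intro image_cong) auto
  moreover have "rows X = p1 ` I" "cols X = p2 ` I" "syms X = p3 ` I"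
      "rows Y = q1 ` I" "cols Y = q2 ` I" "syms Y = q3 ` I"
    unfolding X Y rows_def cols_def syms_def by auto
  ultimately have "isotopic_via X Y \<Phi>"
    unfolding isotopic_via_def bij_betw_def[of \<Phi>]
    using \<phi>1(1) \<phi>2(1) \<phi>3(1) by (auto simp: \<Phi>_def)
  then show thesis
    using that eq by blast
qed

theorem theorem3:
  fixes Q :: "'a set" and mul :: "'a \<Rightarrow> 'a \<Rightarrow> 'a"
    and K :: "('a \<Rightarrow> 'a) monoid" (structure)
    and G :: "('a \<Rightarrow> 'a) set"
    and e1 e2 e3 :: 'a and e :: "'a \<times> 'a \<times> 'a"
    and \<alpha> \<alpha>' a b c :: "'a \<Rightarrow> 'a"
    and A B C :: "('a \<Rightarrow> 'a) set"
    and T T' :: "('a \<times> 'a \<times> 'a) set"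
    and To Ts :: "(('a \<Rightarrow> 'a) set \<times> ('a \<Rightarrow> 'a) set \<times> ('a \<Rightarrow> 'a) set) set"
  assumes "finite_quasigroup Q mul"
    and "K = quasigroup_Aut Q mul"
    and "subgroup G K"
    and "e = (e1, e2, e3)"
    and "e \<in> Ent Q mul"
    and "\<alpha> \<in> G" and "\<alpha>' \<in> G"
    and C1: "\<alpha> \<in> Stab_row G e - Stab_col G e"
    and C2: "\<alpha>' \<in> Stab_col G e"
    and C3: "inv \<alpha>' \<otimes> \<alpha> \<in> Stab_sym G e"
    and B1: "Stab_row G e = generate K {\<alpha>}"
    and B2: "Stab_col G e = generate K {\<alpha>'}"
    and B3: "Stab_sym G e = generate K {inv \<alpha>' \<otimes> \<alpha>}"
    and B4: "card (generate K {\<alpha>} \<inter> generate K {\<alpha>'}) = 1"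
    and "a = inv \<alpha>" and "b = \<alpha>'" and "c = inv \<alpha>' \<otimes> \<alpha>"
    and "A = generate K {a}" and "B = generate K {b}" and "C = generate K {c}"
    and "T = {act g e | g. g \<in> G}"
    and "T' = {act g (e1, e2, \<alpha> e3) | g. g \<in> G}"
    and "To = {(g <# A, g <# B, g <# C) | g. g \<in> G}"
    and "Ts = {(g <# A, g <# B, (g \<otimes> inv a) <# C) | g. g \<in> G}"
  shows "\<exists>\<Theta> \<Theta>'.
           (\<forall>g\<in>G. \<Theta> (act g e) = (g <# A, g <# B, g <# C)) \<and>
           (\<forall>g\<in>G. \<Theta>' (act g (e1, e2, \<alpha> e3)) = (g <# A, g <# B, (g \<otimes> inv a) <# C)) \<and>
           pair_isotopic_via (T, T') (To, Ts) (\<Theta>, \<Theta>')"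
proof -
  interpret K: group K
    using assms(1,2) group_quasigroup_Aut by blast
  note G_mem = subgroup.mem_carrier[OF \<open>subgroup G K\<close>]
  have Q: "e1 \<in> Q" "e2 \<in> Q" "e3 \<in> Q"
    using assms(1,4,5) by (auto simp: Ent_def finite_quasigroup_def)
  have Bij: "g \<in> Bij Q" if "g \<in> G" for g
    using G_mem[OF that] by (simp add: assms(2) quasigroup_Aut_def)
  have mult: "(g \<otimes> h) x = g (h x)" if "g \<in> G" "h \<in> G" "x \<in> Q" for g h x
    using Bij that by (simp add: assms(2) quasigroup_Aut_def BijGroup_def compose_eq)
  have one: "\<one> x = x" if "x \<in> Q" for x
    using that by (simp add: assms(2) quasigroup_Aut_def BijGroup_def)
  \<comment> \<open>The permutations act by themselves, so the action \<open>f\<close> is the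
    identity map.\<close>
  have coset: "g x = h x \<longleftrightarrow> g <# {s \<in> G. s x = x} = h <# {s \<in> G. s x = x}"
    if "x \<in> Q" "g \<in> G" "h \<in> G" for x g h
    using K.l_coset_stabilizer_eq_iff[OF \<open>subgroup G K\<close>, of "\<lambda>g. g" x g h] mult one that by simp
  have "A = {s \<in> G. s e1 = e1}"
    using B1 K.generate_inv_singleton[OF G_mem[OF \<open>\<alpha> \<in> G\<close>]]
    by (simp add: \<open>A = _\<close> \<open>a = _\<close> \<open>e = _\<close> Stab_row_def)
  then have A: "g e1 = h e1 \<longleftrightarrow> g <# A = h <# A" if "g \<in> G" "h \<in> G" for g h
    using coset[OF Q(1)] that by simp
  have "B = {s \<in> G. s e2 = e2}"
    using B2 by (simp add: \<open>B = _\<close> \<open>b = _\<close> \<open>e = _\<close> Stab_col_def)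
  then have B: "g e2 = h e2 \<longleftrightarrow> g <# B = h <# B" if "g \<in> G" "h \<in> G" for g h
    using coset[OF Q(2)] that by simp
  have "C = {s \<in> G. s e3 = e3}"
    using B3 by (simp add: \<open>C = _\<close> \<open>c = _\<close> \<open>e = _\<close> Stab_sym_def)
  then have C: "g e3 = h e3 \<longleftrightarrow> g <# C = h <# C" if "g \<in> G" "h \<in> G" for g h
    using coset[OF Q(3)] that by simp
  have inv_a: "inv a = \<alpha>"
    using G_mem[OF \<open>\<alpha> \<in> G\<close>] by (simp add: \<open>a = _\<close>)
  \<comment> \<open>Applying \<open>coset\<close> at \<open>\<alpha> e3\<close> would give cosets of
    the stabilizer of that point, a conjugate of \<open>C\<close>. Moving \<alpha> into the group
    element keeps the base point \<open>e3\<close> and so the subgroup \<open>C\<close>.\<close>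
  have C': "g (\<alpha> e3) = h (\<alpha> e3) \<longleftrightarrow> (g \<otimes> inv a) <# C = (h \<otimes> inv a) <# C"
    if "g \<in> G" "h \<in> G" for g h
    using C[of "g \<otimes> \<alpha>" "h \<otimes> \<alpha>"] subgroup.m_closed[OF \<open>subgroup G K\<close>] \<open>\<alpha> \<in> G\<close> mult Q(3) that
    by (simp add: inv_a)
  have T: "T = (\<lambda>g. (g e1, g e2, g e3)) ` G"
    and T': "T' = (\<lambda>g. (g e1, g e2, g (\<alpha> e3))) ` G"
    unfolding \<open>T = _\<close> \<open>T' = _\<close> \<open>e = _\<close> act_def by auto
  have To: "To = (\<lambda>g. (g <# A, g <# B, g <# C)) ` G"
    and Ts: "Ts = (\<lambda>g. (g <# A, g <# B, (g \<otimes> inv a) <# C)) ` G"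
    unfolding \<open>To = _\<close> \<open>Ts = _\<close> by auto
  \<comment> \<open>As \<Theta> is a function of triples, its formula for all
    \<open>g \<in> G\<close> includes independence of the \<open>g\<close> representing a
    triple.\<close>
  obtain \<Theta> where "isotopic_via T To \<Theta>"
    and "\<And>g. g \<in> G \<Longrightarrow> \<Theta> (g e1, g e2, g e3) = (g <# A, g <# B, g <# C)"
    using isotopic_via_parametrized[OF T To A B C] by blast
  moreover obtain \<Theta>' where "isotopic_via T' Ts \<Theta>'"
    and "\<And>g. g \<in> G \<Longrightarrow> \<Theta>' (g e1, g e2, g (\<alpha> e3)) = (g <# A, g <# B, (g \<otimes> inv a) <# C)"
    using isotopic_via_parametrized[OF T' Ts A B C'] by blast
  ultimately show ?thesis
    unfolding \<open>e = _\<close> act_def pair_isotopic_via_def by auto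
qed

end
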